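(* Let $A\in\mathbb{R}^{m\times n}$, $b\in\mathbb{R}^m$, $p\in\{1,2\}$, $L\in(0,m)$, and suppose that $A$ satisfies the $p$-Absolute Range Property ($p$-ARP) of order $L$ for some $\psi\in(0,1)$. Let $x_*\in\mathbb{R}^n$ be such that $|Ax_*|^p-b$ is $L$-sparse, i.e. $\||Ax_*|^p-b\|_0\le L$. Then: (i) $x_*$ is a global minimizer over $x\in\mathbb{R}^n$ of $f_p(x):=\||Ax|^p-b\|_1$. (ii) For every $x\in\mathbb{R}^n$, $$\||Ax|^p-|Ax_*|^p\|_1\le \frac{2(1+\psi)}{1-\psi}\,\sigma^p_L(x).$$ (iii) If $\tilde x$ is another global minimizer of $f_p$, then $|A\tilde x|=|Ax_*|$. (iv) If it is further assumed that the entries of $A$ are i.i.d. standard Gaussian $N(0,1)$ random variables and $m\ge 2n-1$, then, with probability $1$, $x_*$ is the unique global minimizer of $f_p$ up to multiplication by $-1$ (that is, almost surely, if the hypotheses above hold for $A,b,x_*$, then $\operatorname{argmin} f_p=\{x_*,-x_*\}$).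
   Context: For a vector $z\in\mathbb{R}^m$, $|z|$ and $z^p$ denote the vectors of entrywise absolute values and entrywise $p$-th powers; $\|z\|_0$ is the number of nonzero entries of $z$; $[m]=\{1,\dots,m\}$; for $T\subseteq[m]$, $z_T\in\mathbb{R}^m$ is the vector with $i$-th entry $z_i$ if $i\in T$ and $0$ otherwise; $T^c=[m]\setminus T$. $p$-ARP: $A\in\mathbb{R}^{m\times n}$ satisfies the $p$-Absolute Range Property of order $L$ for $\psi\in(0,1)$ if $$\|(|Ax|^p-|Ay|^p)_T\|_1\le\psi\,\|(|Ax|^p-|Ay|^p)_{T^c}\|_1\quad\text{for all }x,y\in\mathbb{R}^n\text{ and all }T\subseteq[m]\text{ with }|T|\le L.$$ Residual sparsity measure: for $x\in\mathbb{R}^n$, let $T\subseteq[m]$ be the set of indices of the $L$ largest entries of $\big||Ax|^p-b\big|$ (if $L$ is not an integer, the $\lfloor L\rfloor$ largest; ties are broken arbitrarily), and set $\sigma^p_L(x):=\|(|Ax|^p-b)_{T^c}\|_1$. *)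

theory Defs
  imports "HOL-Probability.Probability"
begin

definition vpow :: "real ^ 'm \<Rightarrow> nat \<Rightarrow> real ^ 'm" where
  "vpow z p = (\<chi> i. (z $ i) ^ p)"

definition restrict_vec :: "real ^ 'm \<Rightarrow> 'm set \<Rightarrow> real ^ 'm" where
  "restrict_vec z T = (\<chi> i. if i \<in> T then z $ i else 0)"

definition l1norm :: "real ^ 'm::finite \<Rightarrow> real" where
  "l1norm z = (\<Sum>i\<in>UNIV. \<bar>z $ i\<bar>)"

definition l0norm :: "real ^ 'm::finite \<Rightarrow> nat" where
  "l0norm z = card {i. z $ i \<noteq> 0}"

definition ARP :: "nat \<Rightarrow> real \<Rightarrow> real \<Rightarrow> real ^ 'n::finite ^ 'm::finite \<Rightarrow> bool" where
  "ARP p L \<psi> A \<longleftrightarrow>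
     (\<forall>x y T. real (card T) \<le> L \<longrightarrow>
        l1norm (restrict_vec (vpow \<bar>A *v x\<bar> p - vpow \<bar>A *v y\<bar> p) T)
        \<le> \<psi> * l1norm (restrict_vec (vpow \<bar>A *v x\<bar> p - vpow \<bar>A *v y\<bar> p) (- T)))"

definition f_obj :: "nat \<Rightarrow> real ^ 'n::finite ^ 'm::finite \<Rightarrow> real ^ 'm \<Rightarrow> real ^ 'n \<Rightarrow> real" where
  "f_obj p A b x = l1norm (vpow \<bar>A *v x\<bar> p - b)"

text \<open>\<open>T\<close> is a set of indices of the \<open>\<lfloor>L\<rfloor>\<close> largest entries of \<open>z\<close>; under ties
  there may be several such sets.\<close>

definition is_largest_set :: "real \<Rightarrow> real ^ 'm::finite \<Rightarrow> 'm set \<Rightarrow> bool" where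
  "is_largest_set L z T \<longleftrightarrow>
     int (card T) = \<lfloor>L\<rfloor> \<and> (\<forall>i\<in>T. \<forall>j\<in>- T. z $ j \<le> z $ i)"

text \<open>The choice operator breaks ties. By \<open>is_largest_set_exists\<close> and \<open>residual_sparsity_eq\<close>
  below, the chosen set exists for \<open>0 \<le> L \<le> m\<close> and the value does not depend on the choice.\<close>

definition residual_sparsity ::
    "nat \<Rightarrow> real \<Rightarrow> real ^ 'n::finite ^ 'm::finite \<Rightarrow> real ^ 'm \<Rightarrow> real ^ 'n \<Rightarrow> real" where
  "residual_sparsity p L A b x =
     (let T = (SOME T. is_largest_set L \<bar>vpow \<bar>A *v x\<bar> p - b\<bar> T)
      in l1norm (restrict_vec (vpow \<bar>A *v x\<bar> p - b) (- T)))"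

lemma largest_set_nat_exists:
  fixes z :: "real ^ 'm::finite"
  assumes "k \<le> CARD('m)"
  shows "\<exists>T. card T = k \<and> (\<forall>i\<in>T. \<forall>j\<in>- T. z $ j \<le> z $ i)"
  using assms
proof (induction k)
  case 0
  show ?case by (intro exI[of _ "{}"]) auto
next
  case (Suc k)
  then obtain T where T: "card T = k" "\<forall>i\<in>T. \<forall>j\<in>- T. z $ j \<le> z $ i" by auto
  have "T \<noteq> UNIV" using T(1) Suc.prems by auto
  then have ne: "(\<lambda>j. z $ j) ` (- T) \<noteq> {}" by auto
  have "Max ((\<lambda>j. z $ j) ` (- T)) \<in> (\<lambda>j. z $ j) ` (- T)"
    by (rule Max_in) (use ne in auto)
  then obtain a where a: "a \<in> - T" "z $ a = Max ((\<lambda>j. z $ j) ` (- T))" by auto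
  have amax: "z $ j \<le> z $ a" if "j \<in> - T" for j
    unfolding a(2) using that by (intro Max_ge) auto
  show ?case
    by (intro exI[of _ "insert a T"]) (use a(1) T amax in \<open>auto simp: card_insert_if\<close>)
qed

lemma is_largest_set_exists:
  fixes z :: "real ^ 'm::finite"
  assumes "0 \<le> L" "L \<le> real CARD('m)"
  shows "\<exists>T. is_largest_set L z T"
proof -
  have "nat \<lfloor>L\<rfloor> \<le> CARD('m)" using assms by linarith
  from largest_set_nat_exists[OF this, of z] show ?thesis
    unfolding is_largest_set_def using assms
    by (metis nat_0_le zero_le_floor)
qed

lemma largest_set_sum_eq:
  fixes z :: "real ^ 'm::finite"
  assumes T: "is_largest_set L z T" and S: "is_largest_set L z S"
  shows "(\<Sum>i\<in>- T. z $ i) = (\<Sum>i\<in>- S. z $ i)"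
proof -
  have c: "card T = card S"
    using T S unfolding is_largest_set_def by linarith
  have cd: "card (S - T) = card (T - S)"
    using c card_Diff_subset_Int[of S T] card_Diff_subset_Int[of T S]
    by (simp add: Int_commute)
  have eq: "z $ i = z $ j" if "i \<in> T - S" "j \<in> S - T" for i j
    using T S that unfolding is_largest_set_def by (intro antisym) auto
  have d: "(\<Sum>i\<in>S - T. z $ i) = (\<Sum>i\<in>T - S. z $ i)"
  proof (cases "T - S = {}")
    case True
    then have "S - T = {}" using cd by (metis card_eq_0_iff finite card.empty)
    then show ?thesis using True by simp
  next
    case False
    then obtain a where a: "a \<in> T - S" by blast
    have "S - T \<noteq> {}" using cd False by (metis card_eq_0_iff finite card.empty)
    then obtain s where s: "s \<in> S - T" by blast
    have "z $ i = z $ a" if "i \<in> S - T" for i using eq[OF a that] by simp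
    moreover have "z $ i = z $ a" if "i \<in> T - S" for i
      using eq[OF that s] eq[OF a s] by simp
    ultimately show ?thesis using cd by simp
  qed
  have "(\<Sum>i\<in>- T. z $ i) = (\<Sum>i\<in>- T \<inter> - S. z $ i) + (\<Sum>i\<in>S - T. z $ i)"
    by (subst sum.union_disjoint[symmetric]) (auto intro!: sum.cong)
  moreover have "(\<Sum>i\<in>- S. z $ i) = (\<Sum>i\<in>- T \<inter> - S. z $ i) + (\<Sum>i\<in>T - S. z $ i)"
    by (subst sum.union_disjoint[symmetric]) (auto intro!: sum.cong)
  ultimately show ?thesis using d by simp
qed

lemma l1norm_restrict_vec: "l1norm (restrict_vec z T) = (\<Sum>i\<in>T. \<bar>z $ i\<bar>)"
  unfolding l1norm_def restrict_vec_def
  by (simp add: if_distrib[of abs] sum.If_cases)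

lemma residual_sparsity_eq:
  fixes A :: "real ^ 'n::finite ^ 'm::finite"
  assumes T: "is_largest_set L \<bar>vpow \<bar>A *v x\<bar> p - b\<bar> T"
  shows "residual_sparsity p L A b x = l1norm (restrict_vec (vpow \<bar>A *v x\<bar> p - b) (- T))"
proof -
  let ?z = "vpow \<bar>A *v x\<bar> p - b"
  have "is_largest_set L \<bar>?z\<bar> (SOME T. is_largest_set L \<bar>?z\<bar> T)"
    using T by (rule someI)
  from largest_set_sum_eq[OF this T] show ?thesis
    unfolding residual_sparsity_def Let_def l1norm_restrict_vec by (simp add: abs_vec_def)
qed

definition ARP_setting ::
    "real ^ 'n::finite ^ 'm::finite \<Rightarrow> real ^ 'm \<Rightarrow> nat \<Rightarrow> real \<Rightarrow> real \<Rightarrow> real ^ 'n \<Rightarrow> bool" where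
  "ARP_setting A b p L \<psi> xs \<longleftrightarrow>
     p \<in> {1, 2} \<and> 0 < L \<and> L < real CARD('m) \<and> 0 < \<psi> \<and> \<psi> < 1 \<and> ARP p L \<psi> A \<and>
     real (l0norm (vpow \<bar>A *v xs\<bar> p - b)) \<le> L"

definition iid_std_normal_entries ::
    "'w measure \<Rightarrow> ('w \<Rightarrow> real ^ 'n::finite ^ 'm::finite) \<Rightarrow> bool" where
  "iid_std_normal_entries M G \<longleftrightarrow>
     prob_space.indep_vars M (\<lambda>_. borel) (\<lambda>(i, j) \<omega>. G \<omega> $ i $ j) UNIV \<and>
     (\<forall>i j. distributed M lborel (\<lambda>\<omega>. G \<omega> $ i $ j) std_normal_density)"

end

theory Submission
  imports Defs
begin

text \<open>
  Write \<open>u = \<bar>A x\<bar>^p - b\<close>, \<open>v = \<bar>A x\<^sub>*\<bar>^p - b\<close> and \<open>w = u - v\<close>. The ARP bounds \<open>w\<close> on any small index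
  set by \<open>w\<close> on the complement. Taking the support of \<open>v\<close> as that set gives
  \<open>\<parallel>u\<parallel> \<ge> \<parallel>v\<parallel> + (1 - \<psi>) \<parallel>w\<^bsub>T\<^sup>c\<^esub>\<parallel>\<close>, which yields minimality and uniqueness of \<open>\<bar>A x\<bar>\<close>; taking
  the largest entries of \<open>u\<close> gives the stability bound.

  For uniqueness up to sign, \<open>\<bar>A x\<bar> = \<bar>A y\<bar>\<close> means that each row of \<open>A\<close> annihilates \<open>x - y\<close> or
  \<open>x + y\<close>. Since \<open>m \<ge> 2n - 1\<close>, one of the two vectors is annihilated by \<open>n\<close> rows, and almost surely
  any \<open>n\<close> rows are linearly independent: the determinant of the \<open>n \<times> n\<close> minor is affine in every
  single entry, so its zero set is null by Fubini and induction on the number of entries.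
\<close>

section \<open>Minimality and stability\<close>

lemma l1norm_split:
  "l1norm z = l1norm (restrict_vec z T) + l1norm (restrict_vec z (- T))"
  unfolding l1norm_restrict_vec
  unfolding l1norm_def
  using sum.subset_diff[of T UNIV "\<lambda>i. \<bar>z $ i\<bar>"] by (simp add: Compl_eq_Diff_UNIV)

lemma l1norm_nonneg: "0 \<le> l1norm z"
  by (simp add: l1norm_def sum_nonneg)

lemma l1norm_triangle: "l1norm (y + z) \<le> l1norm y + l1norm z"
  unfolding l1norm_def by (simp add: sum.distrib[symmetric] sum_mono)

lemma l1norm_triangle_sub: "l1norm y \<le> l1norm z + l1norm (y - z)"
  using l1norm_triangle[of z "y - z"] by simp

lemma l1norm_minus_commute: "l1norm (y - z) = l1norm (z - y)"
  by (simp add: l1norm_def abs_minus_commute)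

lemma l1norm_eq_0_iff: "l1norm z = 0 \<longleftrightarrow> z = 0"
  by (simp add: l1norm_def sum_nonneg_eq_0_iff vec_eq_iff)

lemma restrict_vec_diff: "restrict_vec (y - z) T = restrict_vec y T - restrict_vec z T"
  by (simp add: restrict_vec_def vec_eq_iff)

lemma restrict_vec_support: "restrict_vec z (- {i. z $ i \<noteq> 0}) = 0"
  by (simp add: restrict_vec_def vec_eq_iff)

lemma vpow_inject:
  assumes "0 < p" "vpow \<bar>y\<bar> p = vpow \<bar>z\<bar> p"
  shows "\<bar>y\<bar> = \<bar>z\<bar>"
  using assms by (auto simp: vpow_def vec_eq_iff abs_vec_def intro: power_eq_imp_eq_base)

text \<open>Off the support of \<open>v\<close> the vectors \<open>u\<close> and
  \<open>u - v\<close> agree, so the tail of \<open>u - v\<close> counts in full towards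
  \<open>l1norm u\<close>. On the support, passing from \<open>v\<close> to \<open>u\<close> loses
  at most the head of \<open>u - v\<close>, hence at most \<open>\<psi>\<close> times that
  tail.\<close>

lemma sparse_l1norm_lower_bound:
  assumes dom: "l1norm (restrict_vec (u - v) T) \<le> \<psi> * l1norm (restrict_vec (u - v) (- T))"
    and T: "T = {i. v $ i \<noteq> 0}"
  shows "l1norm v + (1 - \<psi>) * l1norm (restrict_vec (u - v) (- T)) \<le> l1norm u"
proof -
  have v0: "restrict_vec v (- T) = 0"
    unfolding T by (rule restrict_vec_support)
  have v: "l1norm v = l1norm (restrict_vec v T)"
    using l1norm_split[of v T] v0 l1norm_eq_0_iff by (metis add.right_neutral)
  have "l1norm (restrict_vec v T)
      \<le> l1norm (restrict_vec u T) + l1norm (restrict_vec (u - v) T)"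
    using l1norm_triangle_sub[of "restrict_vec v T" "restrict_vec u T"]
    by (simp add: restrict_vec_diff l1norm_minus_commute)
  moreover have "restrict_vec (u - v) (- T) = restrict_vec u (- T)"
    by (simp add: restrict_vec_diff v0)
  ultimately show ?thesis
    using dom l1norm_split[of u T] v by (simp add: algebra_simps)
qed

text \<open>Here \<open>v\<close> may have mass off \<open>T\<close>. Comparing the total norms
  bounds its tail by the tail of \<open>u\<close> plus the head of \<open>u - v\<close>. The tail of
  \<open>u - v\<close> is thus at most twice the tail of \<open>u\<close> plus \<open>\<psi>\<close>
  times itself; solving for it gives the factor 2 / (1 - \<psi>), and adding the head gives 1 +
  \<psi>.\<close>

lemma l1norm_diff_le_tail:
  assumes dom: "l1norm (restrict_vec (u - v) T) \<le> \<psi> * l1norm (restrict_vec (u - v) (- T))"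
    and le: "l1norm v \<le> l1norm u" and psi: "0 \<le> \<psi>" "\<psi> < 1"
  shows "l1norm (u - v) \<le> 2 * (1 + \<psi>) / (1 - \<psi>) * l1norm (restrict_vec u (- T))"
proof -
  let ?c = "l1norm (restrict_vec (u - v) (- T))"
  have "l1norm (restrict_vec u T)
      \<le> l1norm (restrict_vec v T) + l1norm (restrict_vec (u - v) T)"
    using l1norm_triangle_sub by (simp add: restrict_vec_diff)
  moreover have "?c \<le> l1norm (restrict_vec u (- T)) + l1norm (restrict_vec v (- T))"
    using l1norm_triangle_sub[of "restrict_vec u (- T) - restrict_vec v (- T)"
        "restrict_vec u (- T)"] l1norm_minus_commute[of 0 "restrict_vec v (- T)"]
    by (simp add: restrict_vec_diff)
  ultimately have "(1 - \<psi>) * ?c \<le> 2 * l1norm (restrict_vec u (- T))"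
    using dom le l1norm_split[of u T] l1norm_split[of v T] by (simp add: algebra_simps)
  then have "?c \<le> 2 / (1 - \<psi>) * l1norm (restrict_vec u (- T))"
    using psi by (simp add: field_simps)
  then have "(1 + \<psi>) * ?c \<le> (1 + \<psi>) * (2 / (1 - \<psi>) * l1norm (restrict_vec u (- T)))"
    using psi by (intro mult_left_mono) auto
  moreover have "l1norm (u - v) \<le> (1 + \<psi>) * ?c"
    using dom l1norm_split[of "u - v" T] by (simp add: algebra_simps)
  ultimately show ?thesis by (simp add: algebra_simps)
qed

text \<open>The vector \<open>b\<close> cancels, so this is the ARP for the pair \<open>x\<close>,
  \<open>xs\<close>, put in terms of residuals to fit the two norm estimates above.\<close>

lemma ARP_setting_dominated:
  assumes "ARP_setting A b p L \<psi> xs" "real (card T) \<le> L"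
  defines "w \<equiv> \<lambda>x. (vpow \<bar>A *v x\<bar> p - b) - (vpow \<bar>A *v xs\<bar> p - b)"
  shows "l1norm (restrict_vec (w x) T) \<le> \<psi> * l1norm (restrict_vec (w x) (- T))"
  using assms by (simp add: ARP_setting_def ARP_def)

lemma ARP_setting_f_obj:
  assumes s: "ARP_setting A b p L \<psi> xs"
  shows "f_obj p A b xs \<le> f_obj p A b x"
    and "f_obj p A b x \<le> f_obj p A b xs \<Longrightarrow> \<bar>A *v x\<bar> = \<bar>A *v xs\<bar>"
proof -
  let ?u = "vpow \<bar>A *v x\<bar> p - b" and ?v = "vpow \<bar>A *v xs\<bar> p - b"
  define T where "T = {i. ?v $ i \<noteq> 0}"
  let ?c = "l1norm (restrict_vec (?u - ?v) (- T))"
  have psi: "0 < \<psi>" "\<psi> < 1" and p: "p \<in> {1, 2}" and T: "real (card T) \<le> L"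
    using s by (simp_all add: ARP_setting_def l0norm_def T_def)
  note dom = ARP_setting_dominated[OF s T, of x]
  have main: "l1norm ?v + (1 - \<psi>) * ?c \<le> l1norm ?u"
    by (rule sparse_l1norm_lower_bound[OF dom T_def])
  moreover have "0 \<le> (1 - \<psi>) * ?c"
    using psi by (intro mult_nonneg_nonneg l1norm_nonneg) simp
  ultimately show "f_obj p A b xs \<le> f_obj p A b x"
    by (simp add: f_obj_def)
  assume "f_obj p A b x \<le> f_obj p A b xs"
  then have "(1 - \<psi>) * ?c \<le> 0"
    using main by (simp add: f_obj_def)
  then have "?c = 0"
    using psi l1norm_nonneg[of "restrict_vec (?u - ?v) (- T)"] by (simp add: mult_le_0_iff)
  \<comment> \<open>The head is at most \<open>\<psi>\<close> times the tail, so it vanishes with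
    it.\<close>
  then have "l1norm (?u - ?v) = 0"
    using dom l1norm_split[of "?u - ?v" T] l1norm_nonneg[of "?u - ?v"] by simp
  then have "vpow \<bar>A *v x\<bar> p = vpow \<bar>A *v xs\<bar> p"
    by (simp add: l1norm_eq_0_iff)
  then show "\<bar>A *v x\<bar> = \<bar>A *v xs\<bar>"
    by (rule vpow_inject[rotated]) (use p in auto)
qed

lemma ARP_setting_stability:
  fixes A :: "real ^ 'n::finite ^ 'm::finite"
  assumes s: "ARP_setting A b p L \<psi> xs"
  shows "l1norm (vpow \<bar>A *v x\<bar> p - vpow \<bar>A *v xs\<bar> p)
         \<le> 2 * (1 + \<psi>) / (1 - \<psi>) * residual_sparsity p L A b x"
proof -
  let ?u = "vpow \<bar>A *v x\<bar> p - b" and ?v = "vpow \<bar>A *v xs\<bar> p - b"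
  have L: "0 < L" "L < real CARD('m)" and psi: "0 < \<psi>" "\<psi> < 1"
    using s by (simp_all add: ARP_setting_def)
  obtain T where T: "is_largest_set L \<bar>?u\<bar> T"
    using is_largest_set_exists[OF less_imp_le less_imp_le, OF L] by blast
  \<comment> \<open>Rounding down keeps \<open>T\<close> within the order of the ARP.\<close>
  then have "int (card T) = \<lfloor>L\<rfloor>"
    by (simp add: is_largest_set_def)
  then have card: "real (card T) \<le> L"
    by linarith
  have le: "l1norm ?v \<le> l1norm ?u"
    using ARP_setting_f_obj(1)[OF s, of x] by (simp add: f_obj_def)
  have "l1norm (?u - ?v) \<le> 2 * (1 + \<psi>) / (1 - \<psi>) * l1norm (restrict_vec ?u (- T))"
    using psi by (intro l1norm_diff_le_tail ARP_setting_dominated[OF s card] le) simp_all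
  then show ?thesis
    unfolding residual_sparsity_eq[OF T] diff_diff_eq2 diff_add_cancel .
qed

text \<open>The objective sees \<open>x\<close> only through the absolute values of
  \<open>A *v x\<close>, and by the equality case above a minimizer cannot have other absolute
  values than \<open>xs\<close>.\<close>

lemma ARP_setting_is_arg_min_iff:
  assumes "ARP_setting A b p L \<psi> xs"
  shows "is_arg_min (f_obj p A b) (\<lambda>_. True) x \<longleftrightarrow> \<bar>A *v x\<bar> = \<bar>A *v xs\<bar>"
proof
  assume "is_arg_min (f_obj p A b) (\<lambda>_. True) x"
  then have "f_obj p A b x \<le> f_obj p A b xs"
    by (simp add: is_arg_min_def not_less)
  then show "\<bar>A *v x\<bar> = \<bar>A *v xs\<bar>"
    by (rule ARP_setting_f_obj(2)[OF assms])
next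
  assume "\<bar>A *v x\<bar> = \<bar>A *v xs\<bar>"
  then have "f_obj p A b x = f_obj p A b xs"
    by (simp add: f_obj_def)
  then show "is_arg_min (f_obj p A b) (\<lambda>_. True) x"
    using ARP_setting_f_obj(1)[OF assms] by (auto simp: is_arg_min_def not_less)
qed

section \<open>Gaussian matrices have full spark\<close>

text \<open>Models the zero set of a function affine in each coordinate: every axis-parallel line
  meets \<open>Z\<close> in a null set or lies inside it. The point \<open>x0\<close> rules out that
  \<open>Z\<close> is the whole space.\<close>

lemma (in product_sigma_finite) emeasure_PiM_eq_0_if_slices:
  assumes "finite I" "Z \<in> sets (PiM I M)" "x0 \<in> space (PiM I M)" "x0 \<notin> Z"
    and "\<And>x i. x \<in> space (PiM I M) \<Longrightarrow> i \<in> I \<Longrightarrow>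
        {t \<in> space (M i). x(i := t) \<in> Z} \<in> null_sets (M i) \<or>
        {t \<in> space (M i). x(i := t) \<in> Z} = space (M i)"
  shows "emeasure (PiM I M) Z = 0"
  using assms
proof (induction I arbitrary: Z x0 rule: finite_induct)
  case empty
  then have "Z = {}"
    using sets.sets_into_space[OF empty.prems(1)] by (auto simp: space_PiM_empty)
  then show ?case by simp
next
  case (insert i I)
  note Z[measurable] = insert.prems(1)
  \<comment> \<open>The slice of \<open>Z\<close> at height \<open>x0 i\<close> still misses the
    projection of \<open>x0\<close>, so the induction hypothesis applies to it.\<close>
  define Z' where "Z' = {x \<in> space (PiM I M). x(i := x0 i) \<in> Z}"
  have x0i: "x0 i \<in> space (M i)"
    using insert.prems(2) by (auto simp: space_PiM)
  have upd: "x(i := t) \<in> space (PiM (insert i I) M)"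
    if "x \<in> space (PiM I M)" "t \<in> space (M i)" for x t
    using that by (auto simp: space_PiM PiE_def extensional_def)
  have "(\<lambda>x. x(i := x0 i)) \<in> measurable (PiM I M) (PiM (insert i I) M)"
    using x0i by (intro measurable_fun_upd[of _ I]) auto
  then have Z'm: "Z' \<in> sets (PiM I M)"
    unfolding Z'_def by measurable
  have "emeasure (PiM I M) Z' = 0"
  proof (rule insert.IH[OF Z'm])
    \<comment> \<open>Elements of a product space are \<open>undefined\<close> off the index set, so
      dropping coordinate \<open>i\<close> means resetting it.\<close>
    show "x0(i := undefined) \<in> space (PiM I M)"
      using insert.prems(2) insert.hyps by (auto simp: space_PiM PiE_def extensional_def)
    show "x0(i := undefined) \<notin> Z'"
      using insert.prems(3) by (simp add: Z'_def)
    fix x j assume x: "x \<in> space (PiM I M)" and j: "j \<in> I"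
    have "j \<noteq> i"
      using j insert.hyps by auto
    then have "{t \<in> space (M j). x(j := t) \<in> Z'} = {t \<in> space (M j). (x(i := x0 i))(j := t) \<in> Z}"
      using x j by (auto simp: Z'_def fun_upd_twist[of j i] space_PiM PiE_def extensional_def)
    then show "{t \<in> space (M j). x(j := t) \<in> Z'} \<in> null_sets (M j) \<or>
        {t \<in> space (M j). x(j := t) \<in> Z'} = space (M j)"
      by (simp only:) (rule insert.prems(4)[OF upd[OF x x0i] insertI2[OF j]])
  qed
  then have AE: "AE x in PiM I M. x \<notin> Z'"
    using Z'm by (intro AE_not_in) auto
  have slice: "(\<integral>\<^sup>+ t. indicator Z (x(i := t)) \<partial>M i) = 0"
    if x: "x \<in> space (PiM I M)" and "x \<notin> Z'" for x
  proof -
    let ?S = "{t \<in> space (M i). x(i := t) \<in> Z}"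
    \<comment> \<open>The line over \<open>x\<close> leaves \<open>Z\<close> at height
      \<open>x0 i\<close>, so only the null alternative remains.\<close>
    have "x0 i \<notin> ?S"
      using that by (auto simp: Z'_def)
    then have "?S \<noteq> space (M i)"
      using x0i by auto
    then have null: "?S \<in> null_sets (M i)"
      using insert.prems(4)[OF upd[OF x x0i] insertI1] unfolding fun_upd_upd by blast
    have "(\<integral>\<^sup>+ t. indicator Z (x(i := t)) \<partial>M i) = (\<integral>\<^sup>+ t. indicator ?S t \<partial>M i)"
      by (intro nn_integral_cong) (auto simp: indicator_def)
    also have "\<dots> = emeasure (M i) ?S"
      using null by (intro nn_integral_indicator) (rule null_setsD2)
    finally show ?thesis
      using null_setsD1[OF null] by (rule trans)
  qed
  have "emeasure (PiM (insert i I) M) Z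
      = (\<integral>\<^sup>+ x. (\<integral>\<^sup>+ t. indicator Z (x(i := t)) \<partial>M i) \<partial>PiM I M)"
    using product_nn_integral_insert[OF insert.hyps(1,2) borel_measurable_indicator[OF Z]]
      nn_integral_indicator[OF Z] by (simp only:)
  also have "\<dots> = (\<integral>\<^sup>+ x. 0 \<partial>PiM I M)"
    by (rule nn_integral_cong_AE) (use AE slice in auto)
  finally show ?case by simp
qed

text \<open>As \<open>\<sigma>\<close> is injective, the entry \<open>e\<close> lies in at most one
  row of the minor, and the determinant is linear in each row.\<close>

lemma det_minor_entry_affine:
  fixes x :: "'m \<times> 'n::finite \<Rightarrow> real"
  assumes "inj \<sigma>"
  shows "\<exists>a b. \<forall>t. det (\<chi> i j. (x(e := t)) (\<sigma> i, j)) = a + t * b"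
proof (cases "fst e \<in> range \<sigma>")
  case False
  then have "(x(e := t)) (\<sigma> i, j) = x (\<sigma> i, j)" for t i j
    by (auto simp: fun_upd_def)
  then show ?thesis
    by (intro exI[of _ "det (\<chi> i j. x (\<sigma> i, j))"] exI[of _ 0]) simp
next
  case True
  then obtain k l where e: "e = (\<sigma> k, l)"
    by (metis imageE prod.collapse)
  let ?r = "\<lambda>i. \<chi> j. x (\<sigma> i, j)"
  \<comment> \<open>Row \<open>k\<close> is split into its part with entry \<open>l\<close> set to
    zero and \<open>t\<close> times a unit vector.\<close>
  have *: "(\<chi> i j. (x(e := t)) (\<sigma> i, j)) =
      (\<chi> i. if i = k then (\<chi> j. if j = l then 0 else x (\<sigma> k, j)) + t *s axis l 1 else ?r i)" for t
    using assms by (auto simp: vec_eq_iff e axis_def inj_eq)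
  show ?thesis
    unfolding * det_row_add det_row_mul by blast
qed

lemma countable_affine_roots:
  fixes a b :: real
  shows "countable {t. a + t * b = 0} \<or> {t. a + t * b = 0} = UNIV"
proof (cases "b = 0")
  case False
  then have "{t. a + t * b = 0} \<subseteq> {- a / b}"
    by (auto simp: field_simps)
  then have "countable {t. a + t * b = 0}"
    by (rule countable_subset) simp
  then show ?thesis ..
qed auto

lemma AE_det_minor_nonzero:
  fixes G :: "'w \<Rightarrow> real ^ 'n::finite ^ 'm::finite" and \<sigma> :: "'n \<Rightarrow> 'm"
  assumes "prob_space M" and iid: "iid_std_normal_entries M G" and \<sigma>: "inj \<sigma>"
  shows "AE \<omega> in M. det (\<chi> i j. G \<omega> $ \<sigma> i $ j) \<noteq> 0"
proof -
  interpret prob_space M by fact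
  let ?X = "\<lambda>(i, j) \<omega>. G \<omega> $ i $ j"
  define N :: "real measure" where "N = density lborel std_normal_density"
  have setsN[measurable_cong]: "sets N = sets borel" and [simp]: "space N = UNIV"
    by (simp_all add: N_def)
  interpret N: prob_space N
    unfolding N_def by (rule prob_space_normal_density) simp
  interpret product_sigma_finite "\<lambda>_ :: 'm \<times> 'n. N"
    by unfold_locales
  have dist: "distributed M lborel (?X e) std_normal_density" for e
    using iid by (cases e) (simp add: iid_std_normal_entries_def)
  have rv: "random_variable borel (?X e)" for e
    using distributed_measurable[OF dist[of e]] by simp
  have distr: "distr M borel (?X e) = N" for e
    using distributed_distr_eq_density[OF dist[of e]] unfolding N_def
    by (metis distr_cong sets_lborel)
  have "indep_vars (\<lambda>_. borel) ?X UNIV"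
    using iid unfolding iid_std_normal_entries_def by blast
  \<comment> \<open>Independence turns the joint law of the entries into a product measure, where
    the slice lemma applies.\<close>
  then have joint: "distr M (PiM UNIV (\<lambda>_. borel)) (\<lambda>\<omega>. \<lambda>e\<in>UNIV. ?X e \<omega>) = PiM UNIV (\<lambda>_. N)"
    by (subst (asm) indep_vars_iff_distr_eq_PiM[OF UNIV_not_empty rv]) (simp only: distr)
  define f :: "('m \<times> 'n \<Rightarrow> real) \<Rightarrow> real" where "f x = det (\<chi> i j. x (\<sigma> i, j))" for x
  have [measurable]: "f \<in> borel_measurable (PiM UNIV (\<lambda>_. N))"
    unfolding f_def det_def by (simp, measurable)
  define Z where "Z = {x \<in> space (PiM UNIV (\<lambda>_. N)). f x = 0}"
  have Zm: "Z \<in> sets (PiM UNIV (\<lambda>_. N))"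
    unfolding Z_def by measurable
  have spc: "space (PiM UNIV (\<lambda>_ :: 'm \<times> 'n. N)) = UNIV"
    by (simp add: space_PiM)
  \<comment> \<open>\<open>N\<close> has a Lebesgue density, so it inherits the Lebesgue null
    sets.\<close>
  have countable_null: "S \<in> null_sets N" if "countable S" for S
  proof -
    have "S \<in> null_sets lborel"
      using that by (simp add: countable_imp_null_set_lborel)
    then show ?thesis
      unfolding N_def by (auto simp: null_sets_density_iff dest: AE_not_in)
  qed
  have "emeasure (PiM UNIV (\<lambda>_. N)) Z = 0"
  proof (rule emeasure_PiM_eq_0_if_slices[OF finite Zm])
    \<comment> \<open>The rows selected by \<open>\<sigma>\<close> form the identity matrix, whose
      determinant is 1.\<close>
    let ?x0 = "\<lambda>(i, j). if i = \<sigma> j then 1 else 0 :: real"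
    show "?x0 \<in> space (PiM UNIV (\<lambda>_. N))"
      by (simp add: spc)
    have "(\<chi> i j. ?x0 (\<sigma> i, j)) = mat 1"
      using \<sigma> by (simp add: mat_def inj_eq)
    then show "?x0 \<notin> Z"
      by (simp add: Z_def f_def)
    fix x :: "'m \<times> 'n \<Rightarrow> real" and e
    obtain a b where ab: "\<And>t. f (x(e := t)) = a + t * b"
      using det_minor_entry_affine[OF \<sigma>, of x e] unfolding f_def by blast
    have "{t \<in> space N. x(e := t) \<in> Z} = {t. a + t * b = 0}"
      by (simp add: Z_def spc ab)
    then show "{t \<in> space N. x(e := t) \<in> Z} \<in> null_sets N \<or>
        {t \<in> space N. x(e := t) \<in> Z} = space N"
      using countable_affine_roots[of a b] countable_null by auto
  qed
  then have "AE x in PiM UNIV (\<lambda>_. N). f x \<noteq> 0"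
    using Zm by (intro AE_I[of _ _ Z]) (auto simp: Z_def)
  then have "AE x in distr M (PiM UNIV (\<lambda>_. borel)) (\<lambda>\<omega>. \<lambda>e\<in>UNIV. ?X e \<omega>). f x \<noteq> 0"
    unfolding joint .
  then have "AE \<omega> in M. f (\<lambda>e\<in>UNIV. ?X e \<omega>) \<noteq> 0"
    by (rule AE_distrD[rotated]) (use rv in \<open>intro measurable_restrict, auto\<close>)
  then show ?thesis
    by (simp add: f_def)
qed

section \<open>Uniqueness up to sign for matrices of full spark\<close>

lemma eq_0_if_orthogonal_rows:
  fixes A :: "real ^ 'n::finite ^ 'm::finite"
  assumes spark: "\<And>\<sigma> :: 'n \<Rightarrow> 'm. inj \<sigma> \<Longrightarrow> det (\<chi> i j. A $ \<sigma> i $ j) \<noteq> 0"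
    and card: "CARD('n) \<le> card S" and zero: "\<And>i. i \<in> S \<Longrightarrow> (A *v z) $ i = 0"
  shows "z = 0"
proof -
  obtain \<sigma> :: "'n \<Rightarrow> 'm" where \<sigma>: "range \<sigma> \<subseteq> S" "inj \<sigma>"
    using card_le_inj[OF finite finite card] by auto
  let ?B = "\<chi> i j. A $ \<sigma> i $ j"
  have "invertible ?B"
    using spark[OF \<sigma>(2)] by (simp add: invertible_det_nz)
  moreover have "?B *v z = 0"
    using zero \<sigma>(1) by (auto simp: vec_eq_iff matrix_vector_mult_def)
  ultimately show ?thesis
    using matrix_left_invertible_ker[of ?B] invertible_left_inverse[of ?B] by blast
qed

lemma eq_up_to_sign_if_full_spark:
  fixes A :: "real ^ 'n::finite ^ 'm::finite"
  assumes spark: "\<And>\<sigma> :: 'n \<Rightarrow> 'm. inj \<sigma> \<Longrightarrow> det (\<chi> i j. A $ \<sigma> i $ j) \<noteq> 0"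
    and m: "2 * CARD('n) - 1 \<le> CARD('m)" and eq: "\<bar>A *v x\<bar> = \<bar>A *v y\<bar>"
  shows "x = y \<or> x = - y"
proof -
  define S where "S = {i. (A *v x) $ i = (A *v y) $ i}"
  have abs: "\<bar>(A *v x) $ i\<bar> = \<bar>(A *v y) $ i\<bar>" for i
    using eq by (simp add: abs_vec_def vec_eq_iff)
  \<comment> \<open>Pigeonhole: if both sets had at most n - 1 elements, m would be at most 2n -
    2.\<close>
  have "card S + card (- S) = CARD('m)"
    by (metis card_Un_disjoint Compl_disjoint Compl_partition finite)
  then consider "CARD('n) \<le> card S" | "CARD('n) \<le> card (- S)"
    using m by linarith
  then show ?thesis
  proof cases
    case 1
    have "x - y = 0"
      by (rule eq_0_if_orthogonal_rows[OF spark 1])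
         (auto simp: S_def matrix_vector_mult_diff_distrib)
    then show ?thesis by simp
  next
    case 2
    have "x + y = 0"
      by (rule eq_0_if_orthogonal_rows[OF spark 2])
         (use abs in \<open>auto simp: S_def matrix_vector_right_distrib abs_eq_iff add_eq_0_iff2\<close>)
    then show ?thesis by (simp add: add_eq_0_iff2)
  qed
qed

theorem theorem3p2:
  fixes M :: "'w measure" and G :: "'w \<Rightarrow> real ^ 'n::finite ^ 'm::finite"
  shows
    "(\<forall>(A :: real ^ 'n ^ 'm) b p L \<psi> xs. ARP_setting A b p L \<psi> xs \<longrightarrow>
        is_arg_min (f_obj p A b) (\<lambda>_. True) xs \<and>
        (\<forall>x. l1norm (vpow \<bar>A *v x\<bar> p - vpow \<bar>A *v xs\<bar> p)
              \<le> 2 * (1 + \<psi>) / (1 - \<psi>) * residual_sparsity p L A b x) \<and>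
        (\<forall>xt. is_arg_min (f_obj p A b) (\<lambda>_. True) xt \<longrightarrow> \<bar>A *v xt\<bar> = \<bar>A *v xs\<bar>))
     \<and>
     (prob_space M \<and> iid_std_normal_entries M G \<and> CARD('m) \<ge> 2 * CARD('n) - 1 \<longrightarrow>
        (AE \<omega> in M. \<forall>b p L \<psi> xs. ARP_setting (G \<omega>) b p L \<psi> xs \<longrightarrow>
           {x. is_arg_min (f_obj p (G \<omega>) b) (\<lambda>_. True) x} = {xs, - xs}))"
proof (intro conjI allI impI; (elim conjE)?)
  fix A :: "real ^ 'n ^ 'm" and b p L \<psi> xs
  assume s: "ARP_setting A b p L \<psi> xs"
  show "is_arg_min (f_obj p A b) (\<lambda>_. True) xs"
    by (simp add: ARP_setting_is_arg_min_iff[OF s])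
  show "l1norm (vpow \<bar>A *v x\<bar> p - vpow \<bar>A *v xs\<bar> p)
      \<le> 2 * (1 + \<psi>) / (1 - \<psi>) * residual_sparsity p L A b x" for x
    by (rule ARP_setting_stability[OF s])
  show "\<bar>A *v xt\<bar> = \<bar>A *v xs\<bar>" if "is_arg_min (f_obj p A b) (\<lambda>_. True) xt" for xt
    using that by (simp add: ARP_setting_is_arg_min_iff[OF s])
next
  assume G: "prob_space M" "iid_std_normal_entries M G" and m: "2 * CARD('n) - 1 \<le> CARD('m)"
  \<comment> \<open>There are finitely many \<open>\<sigma>\<close>, so one null set serves all
    minors; it is fixed before \<open>b\<close>, \<open>p\<close>, \<open>L\<close>,
    \<open>\<psi>\<close> and \<open>xs\<close> are chosen, which may therefore depend on
    \<open>\<omega>\<close>.\<close>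
  have "AE \<omega> in M. \<forall>\<sigma> \<in> {\<sigma> :: 'n \<Rightarrow> 'm. inj \<sigma>}. det (\<chi> i j. G \<omega> $ \<sigma> i $ j) \<noteq> 0"
    by (intro AE_finite_allI finite, unfold mem_Collect_eq) (rule AE_det_minor_nonzero[OF G])
  then show "AE \<omega> in M. \<forall>b p L \<psi> xs. ARP_setting (G \<omega>) b p L \<psi> xs \<longrightarrow>
      {x. is_arg_min (f_obj p (G \<omega>) b) (\<lambda>_. True) x} = {xs, - xs}"
  proof (rule AE_mp, intro AE_I2 impI allI)
    fix \<omega> b p L \<psi> xs
    assume "\<forall>\<sigma> \<in> {\<sigma> :: 'n \<Rightarrow> 'm. inj \<sigma>}. det (\<chi> i j. G \<omega> $ \<sigma> i $ j) \<noteq> 0"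
    then have spark: "\<bar>G \<omega> *v x\<bar> = \<bar>G \<omega> *v xs\<bar> \<Longrightarrow> x = xs \<or> x = - xs" for x
      using eq_up_to_sign_if_full_spark[OF _ m, of "G \<omega>" x xs] by simp
    assume s: "ARP_setting (G \<omega>) b p L \<psi> xs"
    have "\<bar>G \<omega> *v - xs\<bar> = \<bar>G \<omega> *v xs\<bar>"
      using matrix_vector_mult_diff_distrib[of "G \<omega>" 0 xs] by (simp add: abs_vec_def)
    then show "{x. is_arg_min (f_obj p (G \<omega>) b) (\<lambda>_. True) x} = {xs, - xs}"
      using spark by (auto simp: ARP_setting_is_arg_min_iff[OF s])
  qed
qed

end
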